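(* Let $f:\mathbb{R}^d\to\mathbb{R}$, $g:\mathbb{R}^d\to\mathbb{R}^n$, $h:\mathbb{R}^d\to\mathbb{R}^m$ be functions and $\Omega\subseteq\mathbb{R}^d$ a closed subset. Let $x^*$ be a local minimizer of $$\min_{x\in\Omega}\ f(x)\quad\text{s.t.}\quad g(x)\le0,\ h(x)=0,$$ where $f$ is Lipschitz around $x^*$ and $g,h$ are smooth around $x^*$. Let $\mathcal J\subseteq\{1,\dots,m\}$ be such that $\{\nabla h_j(x^* ):j\in\mathcal J\}$ is a basis for $\mathrm{span}\{\nabla h_j(x^* ):j=1,\dots,m\}$. Suppose that RCPLD holds at $x^*$, i.e., there exists $\delta>0$ such that (i) $\{\nabla h_j(x):j=1,\dots,m\}$ has the same rank for each $x\in\mathcal B_\delta(x^* )$; (ii) for each $\mathcal I\subseteq\mathcal I_g(x^* )$, if there exist $\{\lambda_i\ge0:i\in\mathcal I\}$ and $\{\mu_j:j\in\mathcal J\}$ not all zero such that $$0\in\sum_{i\in\mathcal I}\lambda_i\nabla g_i(x^* )+\sum_{j\in\mathcal J}\mu_j\nabla h_j(x^* )+\mathcal N_\Omega(x^* ),$$ then $\{\nabla g_i(x),\nabla h_j(x):i\in\mathcal I,\ j\in\mathcal J\}$ is linearly dependent for each $x\in\mathcal B_\delta(x^* )$. Then there exist multipliers $\lambda\in\mathbb{R}^n$ and $\mu\in\mathbb{R}^m$ such that $$0\in\partial f(x^* )+\sum_{i=1}^n\lambda_i\nabla g_i(x^* )+\sum_{j=1}^m\mu_j\nabla h_j(x^*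 )+\mathcal N_\Omega(x^* ),\qquad\lambda_i\ge0,\ \lambda_ig_i(x^* )=0,\ i=1,\dots,n.$$
   Context: "Smooth" means continuously differentiable. $\mathcal B_\delta(x^* )$ is the closed ball of radius $\delta$ centered at $x^*$. $\mathcal I_g(x^* )=\{i:g_i(x^* )=0\}$. For $\varphi$ finite at $\bar x$: $\hat\partial\varphi(\bar x)=\{v:\varphi(x)\ge\varphi(\bar x)+v^T(x-\bar x)+o(\|x-\bar x\|)\ \forall x\}$ (regular subdifferential) and $\partial\varphi(\bar x)=\{v:\exists x^k\to\bar x,\ \varphi(x^k)\to\varphi(\bar x),\ v^k\in\hat\partial\varphi(x^k),\ v^k\to v\}$ (limiting subdifferential). $\mathcal N_\Omega(\bar x)=\partial\delta_\Omega(\bar x)$ is the limiting normal cone, $\delta_\Omega$ being the indicator function of $\Omega$. *)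

theory Defs
  imports "HOL-Analysis.Analysis" "HOL-Library.Landau_Symbols"
begin

definition gradient :: "('a::euclidean_space \<Rightarrow> real) \<Rightarrow> 'a \<Rightarrow> 'a" where
  "gradient \<phi> x = (THE D. GDERIV \<phi> x :> D)"

definition smooth_around :: "('a::euclidean_space \<Rightarrow> 'b::euclidean_space) \<Rightarrow> 'a \<Rightarrow> bool" where
  "smooth_around F x0 \<longleftrightarrow> (\<exists>U F'. open U \<and> x0 \<in> U \<and>
     (\<forall>x\<in>U. (F has_derivative blinfun_apply (F' x)) (at x)) \<and> continuous_on U F')"

definition lipschitz_around :: "('a::metric_space \<Rightarrow> 'b::metric_space) \<Rightarrow> 'a \<Rightarrow> bool" where
  "lipschitz_around F x0 \<longleftrightarrow> (\<exists>U L. open U \<and> x0 \<in> U \<and> L-lipschitz_on U F)"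

definition local_minimizer_on :: "('a::metric_space \<Rightarrow> real) \<Rightarrow> 'a set \<Rightarrow> 'a \<Rightarrow> bool" where
  "local_minimizer_on f S x0 \<longleftrightarrow>
     x0 \<in> S \<and> (\<exists>\<epsilon>>0. \<forall>x\<in>S \<inter> ball x0 \<epsilon>. f x0 \<le> f x)"

(* Both subdifferentials are empty where the function is not finite. *)
definition regular_subdifferential :: "('a::euclidean_space \<Rightarrow> ereal) \<Rightarrow> 'a \<Rightarrow> 'a set" where
  "regular_subdifferential \<phi> x0 = {v. \<bar>\<phi> x0\<bar> \<noteq> \<infinity> \<and>
     (\<exists>r :: 'a \<Rightarrow> real. r \<in> o[at x0](\<lambda>x. norm (x - x0)) \<and>
        (\<forall>x. \<phi> x \<ge> \<phi> x0 + ereal (v \<bullet> (x - x0)) + ereal (r x)))}"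

definition limiting_subdifferential :: "('a::euclidean_space \<Rightarrow> ereal) \<Rightarrow> 'a \<Rightarrow> 'a set" where
  "limiting_subdifferential \<phi> x0 = {v. \<bar>\<phi> x0\<bar> \<noteq> \<infinity> \<and>
     (\<exists>X V. X \<longlonglongrightarrow> x0 \<and> (\<lambda>k. \<phi> (X k)) \<longlonglongrightarrow> \<phi> x0 \<and>
        (\<forall>k. V k \<in> regular_subdifferential \<phi> (X k)) \<and> V \<longlonglongrightarrow> v)}"

definition indicator_fun :: "'a set \<Rightarrow> 'a \<Rightarrow> ereal" where
  "indicator_fun S x = (if x \<in> S then 0 else \<infinity>)"

definition limiting_normal_cone :: "'a::euclidean_space set \<Rightarrow> 'a \<Rightarrow> 'a set" where
  "limiting_normal_cone S x0 = limiting_subdifferential (indicator_fun S) x0"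

(* Linear dependence of the indexed family (v i) for i in A: unlike "dependent (v ` A)",
   a repeated vector makes the family dependent. *)
definition dependent_family :: "('i \<Rightarrow> 'a::real_vector) \<Rightarrow> 'i set \<Rightarrow> bool" where
  "dependent_family v A \<longleftrightarrow> (\<exists>c. (\<exists>i\<in>A. c i \<noteq> 0) \<and> (\<Sum>i\<in>A. c i *\<^sub>R v i) = 0)"

definition active_indices :: "('a \<Rightarrow> real ^ 'n) \<Rightarrow> 'a \<Rightarrow> 'n set" where
  "active_indices g x0 = {i. g x0 $ i = 0}"

definition feasible_set ::
  "'a set \<Rightarrow> ('a \<Rightarrow> real ^ 'n) \<Rightarrow> ('a \<Rightarrow> real ^ 'm) \<Rightarrow> 'a set" where
  "feasible_set \<Omega> g h = {x \<in> \<Omega>. (\<forall>i. g x $ i \<le> 0) \<and> h x = 0}"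

abbreviation comp_gradient :: "('a::euclidean_space \<Rightarrow> real ^ 'n) \<Rightarrow> 'n \<Rightarrow> 'a \<Rightarrow> 'a" where
  "comp_gradient F i x \<equiv> gradient (\<lambda>y. F y $ i) x"

definition gradient_basis ::
  "('a::euclidean_space \<Rightarrow> real ^ 'm) \<Rightarrow> 'm set \<Rightarrow> 'a \<Rightarrow> bool" where
  "gradient_basis h J x0 \<longleftrightarrow>
     \<not> dependent_family (\<lambda>j. comp_gradient h j x0) J \<and>
     span ((\<lambda>j. comp_gradient h j x0) ` J) = span (range (\<lambda>j. comp_gradient h j x0))"

definition RCPLD ::
  "'a::euclidean_space set \<Rightarrow> ('a \<Rightarrow> real ^ 'n) \<Rightarrow> ('a \<Rightarrow> real ^ 'm) \<Rightarrow> 'm set \<Rightarrow> 'a \<Rightarrow> bool" where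
  "RCPLD \<Omega> g h J x0 \<longleftrightarrow> (\<exists>\<delta>>0.
     (\<exists>r. \<forall>x\<in>cball x0 \<delta>. dim (range (\<lambda>j. comp_gradient h j x)) = r) \<and>
     (\<forall>I \<subseteq> active_indices g x0.
        (\<exists>lam mu. (\<forall>i\<in>I. lam i \<ge> (0::real)) \<and>
           ((\<exists>i\<in>I. lam i \<noteq> 0) \<or> (\<exists>j\<in>J. mu j \<noteq> 0)) \<and>
           0 \<in> {\<Sum>i\<in>I. lam i *\<^sub>R comp_gradient g i x0} + {\<Sum>j\<in>J. mu j *\<^sub>R comp_gradient h j x0}
                 + limiting_normal_cone \<Omega> x0) \<longrightarrow>
        (\<forall>x\<in>cball x0 \<delta>.
           dependent_family
             (case_sum (\<lambda>i. comp_gradient g i x) (\<lambda>j. comp_gradient h j x)) (I <+> J))))"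

end

(* Penalizing the constraints quadratically, with separate arguments y for f and z for the constraints
   coupled by the term k |z - y|^2, gives minimizers (y, z) near x* at which Fermat's rule produces
   approximate multipliers. The constant rank condition (i) rewrites the equality part in terms of the
   gradients indexed by J near x*, and a Caratheodory-type reduction makes the gradients carrying
   nonzero multipliers linearly independent at z; a fixed index set I occurs infinitely often.
   Dividing by 1 + |multipliers| and passing to the limit gives a relation in which the coefficient s
   of the subgradient of f is nonnegative: if s = 0, condition (ii) contradicts the independence at z
   close to x*; if s > 0, division by s yields the claim. *)
theory Submission
  imports Defs
begin

section \<open>Regular subgradients and normal cones\<close>

text \<open>Fermat's rule with a differentiable perturbation: minimality bounds
  \<open>\<phi> x - \<phi> z\<close> from below by \<open>Q z - Q x\<close> near \<open>z\<close>,
  and this equals \<open>(- q) \<bullet> (x - z)\<close> up to the linearization error of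
  \<open>Q\<close>.\<close>

lemma regular_subdifferential_local_min:
  fixes \<phi> :: "'a::euclidean_space \<Rightarrow> ereal"
  assumes proper: "\<And>x. \<phi> x \<noteq> -\<infinity>" and fin: "\<bar>\<phi> z\<bar> \<noteq> \<infinity>" and Q: "GDERIV Q z :> q" and "e > 0"
    and le: "\<And>x. x \<in> ball z e \<Longrightarrow> \<phi> z + ereal (Q z) \<le> \<phi> x + ereal (Q x)"
  shows "- q \<in> regular_subdifferential \<phi> z"
proof -
  \<comment> \<open>The subgradient inequality is demanded for all \<open>x\<close>, while
    minimality is only local. Outside the ball \<open>r\<close> is therefore the exact defect at
    points of finite value; the little-o condition sees only the values near
    \<open>z\<close>.\<close>
  define r where "r x = (if x \<in> ball z e then - (Q x - Q z - (x - z) \<bullet> q)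
      else real_of_ereal (\<phi> x) - real_of_ereal (\<phi> z) + q \<bullet> (x - z))" for x
  have lim: "((\<lambda>y. norm (Q y - Q z - (y - z) \<bullet> q) / norm (y - z)) \<longlongrightarrow> 0) (at z)"
    using Q by (simp add: gderiv_def has_derivative_iff_norm)
  have near: "\<forall>\<^sub>F x in at z. x \<in> ball z e"
    using \<open>e > 0\<close> by (intro eventually_at_in_open') auto
  have "((\<lambda>y. r y / norm (y - z)) \<longlongrightarrow> 0) (at z)"
  proof (rule tendsto_norm_zero_cancel, rule Lim_transform_eventually[OF lim])
    show "\<forall>\<^sub>F y in at z. norm (Q y - Q z - (y - z) \<bullet> q) / norm (y - z) = norm (r y / norm (y - z))"
      using near by eventually_elim (auto simp: r_def abs_minus_commute)
  qed
  then have "r \<in> o[at z](\<lambda>x. norm (x - z))"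
    by (intro smalloI_tendsto) (auto simp: eventually_at_filter)
  moreover have "\<phi> x \<ge> \<phi> z + ereal ((- q) \<bullet> (x - z)) + ereal (r x)" for x
  proof -
    obtain a where a: "\<phi> z = ereal a" using fin by auto
    show ?thesis
    proof (cases "\<phi> x")
      case (real b)
      then show ?thesis using le[of x] a by (auto simp: r_def inner_commute)
    qed (use proper[of x] in auto)
  qed
  ultimately show ?thesis
    using fin unfolding regular_subdifferential_def by blast
qed

lemma regular_normal_in_set:
  "v \<in> regular_subdifferential (indicator_fun S) x \<Longrightarrow> x \<in> S"
  by (auto simp: regular_subdifferential_def indicator_fun_def split: if_splits)

text \<open>The remainder scales along with the normal. This keeps normals in the cone when the
  approximate optimality relation is divided by the size of its multipliers.\<close>

lemma regular_normal_scaleR: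
  assumes "v \<in> regular_subdifferential (indicator_fun S) x" "t > 0"
  shows "t *\<^sub>R v \<in> regular_subdifferential (indicator_fun S) x"
proof -
  have x: "x \<in> S" using assms(1) by (rule regular_normal_in_set)
  obtain r where r: "r \<in> o[at x](\<lambda>y. norm (y - x))"
    and ge: "\<And>y. indicator_fun S y \<ge> indicator_fun S x + ereal (v \<bullet> (y - x)) + ereal (r y)"
    using assms(1) unfolding regular_subdifferential_def by blast
  have "(\<lambda>y. t * r y) \<in> o[at x](\<lambda>y. norm (y - x))" using r by simp
  moreover have "indicator_fun S y \<ge> indicator_fun S x + ereal ((t *\<^sub>R v) \<bullet> (y - x)) + ereal (t * r y)" for y
  proof (cases "y \<in> S")
    case True
    then have "v \<bullet> (y - x) + r y \<le> 0" using ge[of y] x by (simp add: indicator_fun_def)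
    then have "t * (v \<bullet> (y - x) + r y) \<le> 0" using \<open>t > 0\<close> by (simp add: mult_nonneg_nonpos)
    then show ?thesis using True x by (simp add: indicator_fun_def distrib_left)
  qed (simp add: indicator_fun_def)
  moreover have "\<bar>indicator_fun S x\<bar> \<noteq> \<infinity>" using x by (simp add: indicator_fun_def)
  ultimately show ?thesis unfolding regular_subdifferential_def by blast
qed

text \<open>Convergence of the function values comes for free: points that carry regular normals lie
  in \<open>S\<close>, where the indicator is constantly 0.\<close>

lemma limiting_normal_coneI:
  assumes "x0 \<in> S" "X \<longlonglongrightarrow> x0" "V \<longlonglongrightarrow> v"
    and V: "\<And>k. V k \<in> regular_subdifferential (indicator_fun S) (X k)"
  shows "v \<in> limiting_normal_cone S x0"
proof -
  have "indicator_fun S (X k) = 0" for k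
    using regular_normal_in_set[OF V] by (simp add: indicator_fun_def)
  then have "(\<lambda>k. indicator_fun S (X k)) \<longlonglongrightarrow> indicator_fun S x0"
    using assms(1) by (simp add: indicator_fun_def)
  then show ?thesis using assms unfolding limiting_normal_cone_def limiting_subdifferential_def
    by (auto simp: indicator_fun_def)
qed

section \<open>Component gradients of smooth maps\<close>

text \<open>\<open>gradient\<close> is a definite description, so it carries information only after
  existence and uniqueness of the gradient are shown. Its continuity is inherited from the
  continuous derivative through coordinates.\<close>

lemma smooth_around_comp_gradient:
  fixes F :: "'a::euclidean_space \<Rightarrow> real ^ 'n"
  assumes "smooth_around F x0"
  obtains U where "open U" "x0 \<in> U"
    "\<And>x i. x \<in> U \<Longrightarrow> GDERIV (\<lambda>y. F y $ i) x :> comp_gradient F i x"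
    "\<And>i. continuous_on U (comp_gradient F i)" "continuous_on U F"
proof -
  obtain U F' where U: "open U" "x0 \<in> U"
    and F': "\<And>x. x \<in> U \<Longrightarrow> (F has_derivative blinfun_apply (F' x)) (at x)"
    and cont: "continuous_on U F'"
    using assms unfolding smooth_around_def by blast
  \<comment> \<open>The Riesz representer of the linear functional that sends \<open>k\<close> to
    component \<open>i\<close> of \<open>F' x\<close> applied to \<open>k\<close>, written in the
    standard basis so that continuity in \<open>x\<close> is visible.\<close>
  define D where "D i x = (\<Sum>b\<in>Basis. (blinfun_apply (F' x) b $ i) *\<^sub>R b)" for i x
  have D: "GDERIV (\<lambda>y. F y $ i) x :> D i x" if "x \<in> U" for i x
  proof -
    have "((\<lambda>y. F y $ i) has_derivative (\<lambda>k. blinfun_apply (F' x) k $ i)) (at x)"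
      using F'[OF that] by (rule bounded_linear.has_derivative[OF bounded_linear_vec_nth])
    moreover have "blinfun_apply (F' x) k $ i = k \<bullet> D i x" for k
    proof -
      have "blinfun_apply (F' x) k = blinfun_apply (F' x) (\<Sum>b\<in>Basis. (k \<bullet> b) *\<^sub>R b)"
        by (simp add: euclidean_representation)
      then show ?thesis
        by (simp add: D_def blinfun.sum_right blinfun.scaleR_right inner_sum_right mult.commute)
    qed
    ultimately show ?thesis unfolding gderiv_def by simp
  qed
  have uniq: "E = D i x" if "GDERIV (\<lambda>y. F y $ i) x :> E" "x \<in> U" for E i x
  proof -
    have "(\<lambda>k. k \<bullet> E) = (\<lambda>k. k \<bullet> D i x)"
      using that(1) D[OF that(2)] unfolding gderiv_def by (rule has_derivative_unique)
    then have "k \<bullet> (E - D i x) = 0" for k by (metis inner_diff_right right_minus_eq)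
    then show ?thesis by (metis inner_eq_zero_iff right_minus_eq)
  qed
  have grad: "comp_gradient F i x = D i x" if "x \<in> U" for i x
    unfolding gradient_def using D uniq that by (intro the_equality) auto
  have "continuous_on U (D i)" for i
    unfolding D_def by (intro continuous_intros cont)
  then have "continuous_on U (comp_gradient F i)" for i
    using grad by (simp cong: continuous_on_cong)
  moreover have "continuous_on U F"
    by (intro has_derivative_continuous_on) (use F' has_derivative_at_withinI in blast)
  ultimately show thesis using that U D grad by simp
qed

section \<open>Caratheodory reduction of mixed conic and linear combinations\<close>

text \<open>As long as the family is dependent, subtracting a multiple of a linear relation makes
  one coefficient on \<open>I0\<close> vanish and keeps the others nonnegative. Independence of
  \<open>b\<close> on \<open>J\<close> forces every nontrivial relation to involve
  \<open>I0\<close>, so \<open>J\<close> is kept whole; its coefficients are free in sign.\<close>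

lemma conic_reduction:
  fixes a :: "'i \<Rightarrow> 'a::real_vector" and b :: "'j \<Rightarrow> 'a"
  assumes "finite I0" "finite J" "\<And>i. i \<in> I0 \<Longrightarrow> 0 \<le> lam i" "\<not> dependent_family b J"
  shows "\<exists>I lam' mu'. I \<subseteq> I0 \<and> (\<forall>i\<in>I. 0 \<le> lam' i)
    \<and> \<not> dependent_family (case_sum a b) (I <+> J)
    \<and> (\<Sum>i\<in>I. lam' i *\<^sub>R a i) + (\<Sum>j\<in>J. mu' j *\<^sub>R b j)
      = (\<Sum>i\<in>I0. lam i *\<^sub>R a i) + (\<Sum>j\<in>J. (mu j :: real) *\<^sub>R b j)"
  using assms
proof (induction I0 arbitrary: lam mu rule: finite_psubset_induct)
  case (psubset I0)
  show ?case
  proof (cases "dependent_family (case_sum a b) (I0 <+> J)")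
    case False
    then show ?thesis using psubset.prems by blast
  next
    case True
    then obtain c0 where c0: "\<exists>s\<in>I0 <+> J. c0 s \<noteq> 0" "(\<Sum>s\<in>I0 <+> J. c0 s *\<^sub>R case_sum a b s) = 0"
      unfolding dependent_family_def by blast
    have c0': "(\<Sum>i\<in>I0. c0 (Inl i) *\<^sub>R a i) + (\<Sum>j\<in>J. c0 (Inr j) *\<^sub>R b j) = 0"
      using c0(2) psubset.hyps psubset.prems by (simp add: sum.Plus)
    have "\<exists>i\<in>I0. c0 (Inl i) \<noteq> 0"
    proof (rule ccontr)
      assume "\<not> ?thesis"
      then have "(\<Sum>j\<in>J. c0 (Inr j) *\<^sub>R b j) = 0" "\<exists>j\<in>J. c0 (Inr j) \<noteq> 0" using c0' c0(1) by auto
      then show False using psubset.prems unfolding dependent_family_def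
        by (auto dest!: spec[of _ "\<lambda>j. c0 (Inr j)"])
    qed
    then obtain i0 where i0: "i0 \<in> I0" "c0 (Inl i0) \<noteq> 0" by blast
    \<comment> \<open>Multiplying the relation by this sign makes its coefficient at
      \<open>i0\<close> positive, so that the set of candidates for removal is nonempty.\<close>
    define \<sigma> where "\<sigma> = sgn (c0 (Inl i0))"
    define c where "c i = \<sigma> * c0 (Inl i)" for i
    define d where "d j = \<sigma> * c0 (Inr j)" for j
    have cd: "(\<Sum>i\<in>I0. c i *\<^sub>R a i) + (\<Sum>j\<in>J. d j *\<^sub>R b j) = 0"
      using arg_cong[OF c0', of "scaleR \<sigma>"] by (simp add: scaleR_add_right scaleR_sum_right c_def d_def)
    define P where "P = {i\<in>I0. c i > 0}"
    have "c i0 > 0" using i0 by (simp add: c_def \<sigma>_def sgn_if)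
    then have P: "finite P" "P \<noteq> {}" using i0 psubset.hyps by (auto simp: P_def)
    then obtain i1 where i1: "i1 \<in> P" "\<And>i. i \<in> P \<Longrightarrow> lam i1 / c i1 \<le> lam i / c i"
      using ex_is_arg_min_if_finite[OF P, of "\<lambda>i. lam i / c i"] by (auto simp: is_arg_min_def not_less)
    \<comment> \<open>Ratio test: \<open>t\<close> is the largest step for which every
      \<open>lam i - t * c i\<close> stays nonnegative, and the index \<open>i1\<close> attaining
      the minimal ratio reaches zero.\<close>
    define t where "t = lam i1 / c i1"
    have t: "t \<ge> 0" using i1(1) psubset.prems by (auto simp: t_def P_def)
    define lam2 where "lam2 i = lam i - t * c i" for i
    define mu2 where "mu2 j = mu j - t * d j" for j
    have z: "lam2 i1 = 0" using i1(1) by (auto simp: lam2_def t_def P_def)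
    have nn: "lam2 i \<ge> 0" if "i \<in> I0" for i
    proof (cases "i \<in> P")
      case True
      then show ?thesis using i1(2)[OF True] by (auto simp: lam2_def t_def P_def pos_le_divide_eq)
    next
      case False
      then have "t * c i \<le> 0" using that t by (auto simp: P_def mult_nonneg_nonpos)
      then show ?thesis using psubset.prems(2)[OF that] by (simp add: lam2_def)
    qed
    have i1I: "i1 \<in> I0" using i1(1) by (simp add: P_def)
    have "(\<Sum>i\<in>I0. lam2 i *\<^sub>R a i) + (\<Sum>j\<in>J. mu2 j *\<^sub>R b j)
        = (\<Sum>i\<in>I0. lam i *\<^sub>R a i) + (\<Sum>j\<in>J. mu j *\<^sub>R b j)
          - t *\<^sub>R ((\<Sum>i\<in>I0. c i *\<^sub>R a i) + (\<Sum>j\<in>J. d j *\<^sub>R b j))"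
      by (simp add: lam2_def mu2_def scaleR_diff_left sum_subtractf scaleR_sum_right scaleR_add_right)
    also have "(\<Sum>i\<in>I0. lam2 i *\<^sub>R a i) = (\<Sum>i\<in>I0 - {i1}. lam2 i *\<^sub>R a i)"
      using i1I psubset.hyps z by (subst sum.remove[of I0 i1]) auto
    finally have eq: "(\<Sum>i\<in>I0 - {i1}. lam2 i *\<^sub>R a i) + (\<Sum>j\<in>J. mu2 j *\<^sub>R b j)
        = (\<Sum>i\<in>I0. lam i *\<^sub>R a i) + (\<Sum>j\<in>J. mu j *\<^sub>R b j)" by (simp add: cd)
    have "I0 - {i1} \<subset> I0" using i1I by blast
    from psubset.IH[OF this \<open>finite J\<close>, of lam2 mu2] nn psubset.prems(3) eq
    show ?thesis by (smt (verit) DiffD1 Diff_subset subset_trans)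
  qed
qed

section \<open>Localization of penalty minimizers\<close>

text \<open>Minimizers exist for every penalty parameter by compactness. As the parameter grows, a
  cluster point satisfies \<open>P l = 0\<close> and \<open>F l \<le> F x0\<close>, so it can only
  be \<open>x0\<close>; some minimizer is thus within \<epsilon> of it.\<close>

lemma penalty_minimizer_near:
  fixes F P :: "'a::metric_space \<Rightarrow> real"
  assumes "compact K" "continuous_on K F" "continuous_on K P" "\<And>x. x \<in> K \<Longrightarrow> P x \<ge> 0"
    and "x0 \<in> K" "P x0 = 0" "\<epsilon> > 0"
    and uniq: "\<And>x. x \<in> K \<Longrightarrow> P x = 0 \<Longrightarrow> F x \<le> F x0 \<Longrightarrow> x = x0"
  shows "\<exists>k>0. \<exists>x\<in>K. dist x x0 < \<epsilon> \<and> (\<forall>x'\<in>K. F x + k * P x \<le> F x' + k * P x')"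
proof -
  have "\<exists>x\<in>K. \<forall>x'\<in>K. F x + real (Suc n) * P x \<le> F x' + real (Suc n) * P x'" for n
    using assms by (intro continuous_attains_inf continuous_intros) auto
  then obtain X where X: "\<And>n. X n \<in> K"
    and min: "\<And>n x'. x' \<in> K \<Longrightarrow> F (X n) + real (Suc n) * P (X n) \<le> F x' + real (Suc n) * P x'"
    by metis
  obtain m where m: "\<And>x. x \<in> K \<Longrightarrow> m \<le> F x"
    using continuous_attains_inf[OF assms(1) _ assms(2)] assms(5) by blast
  obtain l s where l: "l \<in> K" "strict_mono s" "(X \<circ> s) \<longlonglongrightarrow> l"
    using assms(1) X unfolding compact_def by metis
  have FX: "(\<lambda>n. F (X (s n))) \<longlonglongrightarrow> F l" and PX: "(\<lambda>n. P (X (s n))) \<longlonglongrightarrow> P l"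
    using continuous_on_tendsto_compose[OF assms(2) l(3,1)] continuous_on_tendsto_compose[OF assms(3) l(3,1)] X
    by (auto simp: o_def)
  have le: "F (X n) + real (Suc n) * P (X n) \<le> F x0" for n
    using min[OF assms(5), of n] assms(6) by simp
  have "F (X n) \<le> F x0" for n
    using le[of n] mult_nonneg_nonneg[OF _ assms(4)[OF X[of n]], of "real (Suc n)"] by linarith
  then have "F l \<le> F x0" by (intro LIMSEQ_le_const2[OF FX]) auto
  moreover have "P l = 0"
  proof -
    \<comment> \<open>Comparison with \<open>x0\<close>, where the penalty vanishes, bounds
      parameter times penalty by \<open>F x0 - m\<close>, with \<open>m\<close> a lower bound of
      \<open>F\<close> on \<open>K\<close>.\<close>
    have bound: "P (X n) \<le> (F x0 - m) / real (Suc n)" for n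
      using le[of n] m[OF X[of n]] by (simp add: pos_le_divide_eq mult.commute)
    have lim0: "(\<lambda>n. (F x0 - m) / real (Suc n)) \<longlonglongrightarrow> 0"
      by (rule LIMSEQ_Suc[OF lim_const_over_n])
    have "(\<lambda>n. P (X n)) \<longlonglongrightarrow> 0"
    proof (rule tendsto_sandwich[OF _ _ tendsto_const lim0])
      show "\<forall>\<^sub>F n in sequentially. 0 \<le> P (X n)" using assms(4)[OF X] by simp
      show "\<forall>\<^sub>F n in sequentially. P (X n) \<le> (F x0 - m) / real (Suc n)" using bound by simp
    qed
    from LIMSEQ_subseq_LIMSEQ[OF this l(2)] PX show ?thesis
      by (auto simp: o_def intro: LIMSEQ_unique)
  qed
  ultimately have "l = x0" using uniq l(1) by blast
  then have "\<forall>\<^sub>F n in sequentially. dist ((X \<circ> s) n) x0 < \<epsilon>" using l(3) assms(7) by (simp add: tendsto_iff)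
  then obtain n where "dist (X (s n)) x0 < \<epsilon>" by (auto simp: eventually_sequentially)
  then show ?thesis using X min by (intro exI[of _ "real (Suc (s n))"]) auto
qed

section \<open>Independence of indexed families and its stability\<close>

text \<open>Connects indexed families with the set-based \<open>independent\<close>, to which
  \<open>dim\<close> and \<open>span\<close> refer. Injectivity rules out repeated vectors, which
  the image set would hide.\<close>

lemma dependent_family_iff:
  assumes "finite A"
  shows "\<not> dependent_family v A \<longleftrightarrow> inj_on v A \<and> independent (v ` A)"
proof
  assume nd: "\<not> dependent_family v A"
  have inj: "inj_on v A"
  proof (rule inj_onI, rule ccontr)
    fix x y assume xy: "x \<in> A" "y \<in> A" "v x = v y" "x \<noteq> y"
    define c where "c i = (if i = x then 1 else if i = y then -1 else (0::real))" for i
    have "(\<Sum>i\<in>A. c i *\<^sub>R v i) = (\<Sum>i\<in>{x,y}. c i *\<^sub>R v i)"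
      using xy assms by (intro sum.mono_neutral_right) (auto simp: c_def)
    also have "\<dots> = 0" using xy by (simp add: c_def)
    finally have "(\<Sum>i\<in>A. c i *\<^sub>R v i) = 0" .
    moreover have "c x \<noteq> 0" by (simp add: c_def)
    ultimately show False using nd xy(1) unfolding dependent_family_def by blast
  qed
  have "independent (v ` A)"
  proof
    assume "dependent (v ` A)"
    then obtain u where u: "\<exists>w\<in>v ` A. u w \<noteq> 0" "(\<Sum>w\<in>v ` A. u w *\<^sub>R w) = 0"
      using assms by (auto simp: dependent_finite)
    then have "(\<Sum>i\<in>A. u (v i) *\<^sub>R v i) = 0" using inj by (simp add: sum.reindex)
    then show False using nd u(1) unfolding dependent_family_def by (auto dest!: spec[of _ "\<lambda>i. u (v i)"])
  qed
  with inj show "inj_on v A \<and> independent (v ` A)" by blast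
next
  assume R: "inj_on v A \<and> independent (v ` A)"
  show "\<not> dependent_family v A"
  proof
    assume "dependent_family v A"
    then obtain c i where c: "i \<in> A" "c i \<noteq> 0" "(\<Sum>i\<in>A. c i *\<^sub>R v i) = 0" unfolding dependent_family_def by blast
    then have "(\<Sum>w\<in>v ` A. c (the_inv_into A v w) *\<^sub>R w) = 0"
      using R by (simp add: sum.reindex the_inv_into_f_f)
    then have "dependent (v ` A)"
      using c R assms by (subst dependent_finite) (auto intro!: exI[of _ "\<lambda>w. c (the_inv_into A v w)"] simp: the_inv_into_f_f)
    then show False using R by blast
  qed
qed

lemma tendsto_of_dist_less_inverse_Suc:
  fixes X :: "nat \<Rightarrow> 'a::metric_space"
  assumes "\<And>n. dist x (X n) < inverse (real (Suc n))"
  shows "X \<longlonglongrightarrow> x"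
  using assms by (intro metric_tendsto_imp_tendsto[OF LIMSEQ_inverse_real_of_nat])
    (auto simp: dist_commute intro!: always_eventually less_imp_le)

text \<open>Independence is an open condition: relations at points tending to \<open>x0\<close>,
  normalized to unit coefficient vectors, have a subsequence converging to a nontrivial relation at
  \<open>x0\<close>.\<close>

lemma eventually_independent_family:
  fixes v :: "'i::finite \<Rightarrow> 'b::metric_space \<Rightarrow> 'a::euclidean_space"
  assumes "\<And>i. isCont (v i) x0" "\<not> dependent_family (\<lambda>i. v i x0) A"
  shows "\<exists>e>0. \<forall>x\<in>ball x0 e. \<not> dependent_family (\<lambda>i. v i x) A"
proof (rule ccontr)
  assume "\<not> ?thesis"
  then have "\<forall>n. \<exists>x. dist x0 x < inverse (real (Suc n)) \<and> dependent_family (\<lambda>i. v i x) A"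
    by (metis inverse_positive_iff_positive mem_ball of_nat_0_less_iff zero_less_Suc)
  then obtain X where X: "\<And>n. dist x0 (X n) < inverse (real (Suc n))"
    and dep: "\<And>n. dependent_family (\<lambda>i. v i (X n)) A" by metis
  \<comment> \<open>Extension by zero outside \<open>A\<close> places the normalized coefficients on
    a compact unit sphere.\<close>
  have "\<exists>c :: real ^ 'i. norm c = 1 \<and> (\<forall>i. i \<notin> A \<longrightarrow> c $ i = 0) \<and> (\<Sum>i\<in>UNIV. c $ i *\<^sub>R v i (X n)) = 0" for n
  proof -
    obtain c0 where c0: "\<exists>i\<in>A. c0 i \<noteq> 0" "(\<Sum>i\<in>A. c0 i *\<^sub>R v i (X n)) = 0"
      using dep[of n] unfolding dependent_family_def by blast
    define c :: "real ^ 'i" where "c = (\<chi> i. if i \<in> A then c0 i else 0)"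
    have "c \<noteq> 0" using c0(1) by (auto simp: c_def vec_eq_iff)
    have "(\<Sum>i\<in>UNIV. c $ i *\<^sub>R v i (X n)) = (\<Sum>i\<in>A. c0 i *\<^sub>R v i (X n))"
      by (rule sum.mono_neutral_cong_right) (auto simp: c_def)
    then have "(\<Sum>i\<in>UNIV. (c /\<^sub>R norm c) $ i *\<^sub>R v i (X n)) = 0"
      using c0(2) by (simp add: scaleR_scaleR[symmetric] scaleR_sum_right[symmetric] del: scaleR_scaleR)
    then show ?thesis using \<open>c \<noteq> 0\<close> by (intro exI[of _ "c /\<^sub>R norm c"]) (auto simp: c_def)
  qed
  then obtain c :: "nat \<Rightarrow> real ^ 'i" where c: "\<And>n. norm (c n) = 1" "\<And>n i. i \<notin> A \<Longrightarrow> c n $ i = 0"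
    "\<And>n. (\<Sum>i\<in>UNIV. c n $ i *\<^sub>R v i (X n)) = 0" by metis
  have "\<forall>n. c n \<in> sphere 0 1" by (simp add: c(1))
  then obtain l s where l: "l \<in> sphere 0 1" "strict_mono s" "(c \<circ> s) \<longlonglongrightarrow> l"
    using compact_sphere unfolding compact_def by metis
  have "X \<longlonglongrightarrow> x0" using X by (rule tendsto_of_dist_less_inverse_Suc)
  then have Xs: "(\<lambda>n. X (s n)) \<longlonglongrightarrow> x0" using LIMSEQ_subseq_LIMSEQ[OF _ l(2)] by (simp add: o_def)
  have ci: "(\<lambda>n. c (s n) $ i) \<longlonglongrightarrow> l $ i" for i using tendsto_vec_nth[OF l(3)] by (simp add: o_def)
  have "(\<lambda>n. \<Sum>i\<in>UNIV. c (s n) $ i *\<^sub>R v i (X (s n))) \<longlonglongrightarrow> (\<Sum>i\<in>UNIV. l $ i *\<^sub>R v i x0)"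
    by (intro tendsto_intros ci isCont_tendsto_compose[OF assms(1) Xs])
  then have 0: "(\<Sum>i\<in>UNIV. l $ i *\<^sub>R v i x0) = 0" using c(3) by (simp add: LIMSEQ_const_iff)
  have off: "l $ i = 0" if "i \<notin> A" for i using ci[of i] c(2)[OF that] by (simp add: LIMSEQ_const_iff)
  have "(\<Sum>i\<in>A. l $ i *\<^sub>R v i x0) = (\<Sum>i\<in>UNIV. l $ i *\<^sub>R v i x0)"
    by (rule sum.mono_neutral_left) (auto simp: off)
  moreover have "\<exists>i\<in>A. l $ i \<noteq> 0"
  proof (rule ccontr)
    assume "\<not> ?thesis"
    then have "l = 0" using off by (auto simp: vec_eq_iff)
    then show False using l(1) by simp
  qed
  ultimately show False using assms(2) 0 unfolding dependent_family_def by (auto dest!: spec[of _ "\<lambda>i. l $ i"])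
qed

section \<open>Approximate KKT points from a decoupled quadratic penalty\<close>

lemma gderiv_sum:
  "(\<And>i. i \<in> A \<Longrightarrow> GDERIV (f i) x :> D i) \<Longrightarrow> GDERIV (\<lambda>y. \<Sum>i\<in>A. f i y) x :> (\<Sum>i\<in>A. D i)"
  unfolding gderiv_def inner_sum_right by (rule has_derivative_sum)

lemma gderiv_norm_diff_square:
  "GDERIV (\<lambda>x. (norm (x - c))\<^sup>2) x :> 2 *\<^sub>R (x - c)"
  unfolding gderiv_def power2_norm_eq_inner
  by (auto intro!: derivative_eq_intros simp: inner_commute)

text \<open>As a function of \<open>s\<close>, the right-hand side is a smooth majorant of the
  squared positive part that touches it at \<open>s = t\<close>. A minimizer of the penalized
  problem hence also minimizes the smooth majorant, whose derivative at \<open>t\<close> is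
  \<open>2 * max 0 t\<close>.\<close>

lemma max_0_square_le: "(max 0 s)\<^sup>2 \<le> (max 0 t + s - t)\<^sup>2" for s t :: real
proof (cases "s \<ge> 0")
  case True
  then have "max 0 s \<le> max 0 t + s - t" by simp
  then show ?thesis by (intro power_mono) auto
qed simp

(* The decoupled arguments y and z make the optimality conditions separate, so that no sum rule for
   subdifferentials is needed. *)
lemma approximate_KKT:
  fixes f :: "'a::euclidean_space \<Rightarrow> real" and g :: "'a \<Rightarrow> real ^ 'n" and h :: "'a \<Rightarrow> real ^ 'm"
  assumes "closed \<Omega>" and locmin: "local_minimizer_on f (feasible_set \<Omega> g h) xs"
    and "lipschitz_around f xs" "smooth_around g xs" "smooth_around h xs"
  obtains L where "\<And>\<epsilon>. \<epsilon> > 0 \<Longrightarrow> \<exists>y z u w lam mu. y \<in> ball xs \<epsilon> \<and> z \<in> ball xs \<epsilon> \<and> norm u \<le> L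
    \<and> u \<in> regular_subdifferential (\<lambda>x. ereal (f x)) y
    \<and> w \<in> regular_subdifferential (indicator_fun \<Omega>) z
    \<and> (\<forall>i. 0 \<le> lam i) \<and> (\<forall>i. g xs $ i \<noteq> 0 \<longrightarrow> lam i = 0)
    \<and> u + (\<Sum>i\<in>UNIV. lam i *\<^sub>R comp_gradient g i z) + (\<Sum>j\<in>UNIV. mu j *\<^sub>R comp_gradient h j z) + w = xs - z"
proof -
  obtain Ug where Ug: "open Ug" "xs \<in> Ug"
    and dg: "\<And>x i. x \<in> Ug \<Longrightarrow> GDERIV (\<lambda>y. g y $ i) x :> comp_gradient g i x"
    and cg: "continuous_on Ug g"
    using smooth_around_comp_gradient[OF assms(4)] by metis
  obtain Uh where Uh: "open Uh" "xs \<in> Uh"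
    and dh: "\<And>x j. x \<in> Uh \<Longrightarrow> GDERIV (\<lambda>y. h y $ j) x :> comp_gradient h j x"
    and ch: "continuous_on Uh h"
    using smooth_around_comp_gradient[OF assms(5)] by metis
  obtain Uf L where Uf: "open Uf" "xs \<in> Uf" and lip: "L-lipschitz_on Uf f"
    using assms(3) unfolding lipschitz_around_def by blast
  obtain e0 where xs: "xs \<in> feasible_set \<Omega> g h" and "e0 > 0"
    and lmin: "\<And>x. x \<in> feasible_set \<Omega> g h \<Longrightarrow> x \<in> ball xs e0 \<Longrightarrow> f xs \<le> f x"
    using locmin unfolding local_minimizer_on_def by blast
  have xsf: "xs \<in> \<Omega>" "\<And>i. g xs $ i \<le> 0" "h xs = 0"
    using xs by (auto simp: feasible_set_def)
  have gcont: "isCont g xs" using cg Ug by (simp add: continuous_on_eq_continuous_at)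
  have "\<forall>\<^sub>F x in nhds xs. g xs $ i < 0 \<longrightarrow> g x $ i < 0" for i
  proof (cases "g xs $ i < 0")
    case True
    have "((\<lambda>x. g x $ i) \<longlongrightarrow> g xs $ i) (nhds xs)"
      using gcont by (intro tendsto_intros) (simp add: isCont_def tendsto_at_iff_tendsto_nhds)
    from order_tendstoD(2)[OF this True] show ?thesis by (auto elim: eventually_mono)
  qed simp
  then have "\<forall>\<^sub>F x in nhds xs. \<forall>i. g xs $ i < 0 \<longrightarrow> g x $ i < 0"
    by (simp add: eventually_all_finite)
  moreover have "\<forall>\<^sub>F x in nhds xs. x \<in> Ug \<inter> Uh \<inter> Uf \<inter> ball xs e0"
    using Ug Uh Uf \<open>e0 > 0\<close> by (intro eventually_nhds_in_open) auto
  ultimately have "\<forall>\<^sub>F x in nhds xs. x \<in> Ug \<inter> Uh \<inter> Uf \<inter> ball xs e0 \<and> (\<forall>i. g xs $ i < 0 \<longrightarrow> g x $ i < 0)"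
    by eventually_elim blast
  then obtain d where "d > 0"
    and d: "\<And>x. dist x xs < d \<Longrightarrow> x \<in> Ug \<inter> Uh \<inter> Uf \<inter> ball xs e0 \<and> (\<forall>i. g xs $ i < 0 \<longrightarrow> g x $ i < 0)"
    unfolding eventually_nhds_metric by blast
  \<comment> \<open>Halving \<open>d\<close> makes the closed ball \<open>B\<close> fit inside the
    open ball on which all the local properties hold.\<close>
  define \<rho> where "\<rho> = d / 2"
  have "\<rho> > 0" using \<open>d > 0\<close> by (simp add: \<rho>_def)
  define B where "B = cball xs \<rho>"
  have B: "x \<in> Ug" "x \<in> Uh" "x \<in> Uf" "x \<in> ball xs e0" "\<And>i. g xs $ i < 0 \<Longrightarrow> g x $ i < 0" if "x \<in> B" for x
    using d[of x] that \<open>d > 0\<close> by (auto simp: B_def \<rho>_def dist_commute)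
  define K where "K = B \<times> (\<Omega> \<inter> B)"
  have "compact K" unfolding K_def B_def
    by (intro compact_Times compact_cball closed_Int_compact assms)
  \<comment> \<open>The quadratic term makes \<open>xs\<close> the strict minimizer, as
    \<open>uniq\<close> requires; its gradient \<open>z - xs\<close> is the error left in the final
    relation. The penalty \<open>P\<close> vanishes exactly when \<open>y = z\<close> and
    \<open>z\<close> satisfies the constraints.\<close>
  define F where "F p = f (fst p) + 1/2 * (norm (snd p - xs))\<^sup>2" for p :: "'a \<times> 'a"
  define P where "P p = (norm (snd p - fst p))\<^sup>2 + (\<Sum>i\<in>UNIV. (max 0 (g (snd p) $ i))\<^sup>2)
      + (\<Sum>j\<in>UNIV. (h (snd p) $ j)\<^sup>2)" for p :: "'a \<times> 'a"
  have fB: "continuous_on B f" and gB: "continuous_on B g" and hB: "continuous_on B h"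
    using lipschitz_on_continuous_on[OF lip] cg ch B by (auto intro: continuous_on_subset)
  have f1: "continuous_on K (\<lambda>p. f (fst p))"
    by (rule continuous_on_compose2[OF fB]) (auto intro!: continuous_intros simp: K_def)
  have g1: "continuous_on K (\<lambda>p. g (snd p))"
    by (rule continuous_on_compose2[OF gB]) (auto intro!: continuous_intros simp: K_def)
  have h1: "continuous_on K (\<lambda>p. h (snd p))"
    by (rule continuous_on_compose2[OF hB]) (auto intro!: continuous_intros simp: K_def)
  have FK: "continuous_on K F" unfolding F_def by (intro continuous_intros f1)
  have PK: "continuous_on K P" unfolding P_def
    by (intro continuous_intros g1 h1)
  have P0: "P p \<ge> 0" for p unfolding P_def by (intro add_nonneg_nonneg sum_nonneg) auto
  have xsB: "xs \<in> B" using \<open>\<rho> > 0\<close> by (simp add: B_def)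
  have xsK: "(xs, xs) \<in> K" using xsB xsf by (simp add: K_def)
  have Pxs: "P (xs, xs) = 0" using xsf by (simp add: P_def max_absorb1)
  have uniq: "p = (xs, xs)" if p: "p \<in> K" "P p = 0" "F p \<le> F (xs, xs)" for p
  proof -
    obtain y z where yz: "p = (y, z)" by fastforce
    have S: "(\<Sum>i\<in>UNIV. (max 0 (g z $ i))\<^sup>2) \<ge> 0" "(\<Sum>j\<in>UNIV. (h z $ j)\<^sup>2) \<ge> 0"
      by (auto intro: sum_nonneg)
    have "(norm (z - y))\<^sup>2 + (\<Sum>i\<in>UNIV. (max 0 (g z $ i))\<^sup>2) + (\<Sum>j\<in>UNIV. (h z $ j)\<^sup>2) = 0"
      using p(2) by (simp add: P_def yz)
    then have "(norm (z - y))\<^sup>2 = 0" "(\<Sum>i\<in>UNIV. (max 0 (g z $ i))\<^sup>2) = 0" "(\<Sum>j\<in>UNIV. (h z $ j)\<^sup>2) = 0"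
      using S zero_le_power2[of "norm (z - y)"] by linarith+
    then have "z = y" and gh: "\<forall>i. max 0 (g z $ i) = 0" "\<forall>j. h z $ j = 0"
      by (auto simp: sum_nonneg_eq_0_iff)
    have "g z $ i \<le> 0" for i using gh(1) max.cobounded2[of "g z $ i" 0] by simp
    moreover have "h z = 0" using gh(2) by (simp add: vec_eq_iff)
    moreover have "z \<in> \<Omega>" using p(1) by (simp add: K_def yz)
    ultimately have "z \<in> feasible_set \<Omega> g h" by (simp add: feasible_set_def)
    then have "f xs \<le> f z" using lmin B p(1) by (auto simp: K_def yz)
    moreover have "f z + 1/2 * (norm (z - xs))\<^sup>2 \<le> f xs"
      using p(3) \<open>z = y\<close> by (simp add: F_def yz)
    ultimately have "(norm (z - xs))\<^sup>2 \<le> 0" by linarith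
    then show ?thesis using \<open>z = y\<close> by (simp add: yz)
  qed
  show thesis
  proof (rule that[of "2 * L"])
    fix \<epsilon> :: real assume "\<epsilon> > 0"
    then have "min \<epsilon> \<rho> > 0" using \<open>\<rho> > 0\<close> by simp
    from penalty_minimizer_near[OF \<open>compact K\<close> FK PK P0 xsK Pxs this uniq]
    obtain k p where "k > 0" "p \<in> K" and close: "dist p (xs, xs) < min \<epsilon> \<rho>"
      and min: "\<And>p'. p' \<in> K \<Longrightarrow> F p + k * P p \<le> F p' + k * P p'" by blast
    obtain y z where p: "p = (y, z)" by fastforce
    have "dist y xs < min \<epsilon> \<rho>" "dist z xs < min \<epsilon> \<rho>"
      using close dist_fst_le[of p "(xs, xs)"] dist_snd_le[of p "(xs, xs)"] by (auto simp: p)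
    then have yz: "dist xs y < \<epsilon>" "dist xs y < \<rho>" "dist xs z < \<epsilon>" "dist xs z < \<rho>"
      by (auto simp: dist_commute)
    have yB: "y \<in> B" and zB: "z \<in> B" "z \<in> \<Omega>" using \<open>p \<in> K\<close> by (auto simp: K_def p)
    have inB: "x' \<in> B" if "x' \<in> ball x (\<rho> - dist xs x)" for x x'
      using that dist_triangle[of xs x' x] by (simp add: B_def)
    \<comment> \<open>Minus the gradient in \<open>y\<close> of the coupling term, with
      \<open>z\<close> held fixed.\<close>
    define u where "u = - ((2 * k) *\<^sub>R (y - z))"
    have "u \<in> regular_subdifferential (\<lambda>x. ereal (f x)) y"
      unfolding u_def
    proof (rule regular_subdifferential_local_min)
      have "GDERIV (\<lambda>y'. k * (norm (y' - z))\<^sup>2) y :> k *\<^sub>R (2 *\<^sub>R (y - z))"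
        by (rule GDERIV_DERIV_compose[OF gderiv_norm_diff_square]) (auto intro!: derivative_eq_intros)
      then show "GDERIV (\<lambda>y'. k * (norm (y' - z))\<^sup>2) y :> (2 * k) *\<^sub>R (y - z)"
        by (simp add: mult.commute)
      show "\<rho> - dist xs y > 0" using yz by simp
      fix y' assume "y' \<in> ball y (\<rho> - dist xs y)"
      then have "(y', z) \<in> K" using inB zB by (simp add: K_def)
      from min[OF this] show "ereal (f y) + ereal (k * (norm (y - z))\<^sup>2) \<le> ereal (f y') + ereal (k * (norm (y' - z))\<^sup>2)"
        by (simp add: F_def P_def p norm_minus_commute distrib_left)
    qed auto
    moreover have "norm u \<le> 2 * L"
    proof -
      \<comment> \<open>Replacing \<open>y\<close> by \<open>z\<close> removes the coupling term and
        leaves the rest of the penalty unchanged. The Lipschitz estimate then bounds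
        \<open>k * norm (z - y)\<close> by \<open>L\<close>, however large \<open>k\<close>
        is.\<close>
      have "(z, z) \<in> K" using zB by (simp add: K_def)
      from min[OF this] have "k * (norm (z - y))\<^sup>2 \<le> f z - f y"
        by (simp add: F_def P_def p distrib_left)
      also have "\<dots> \<le> L * norm (z - y)"
        using lipschitz_onD[OF lip, of z y] B(3) yB zB by (auto simp: dist_norm)
      finally have "(k * norm (z - y)) * norm (z - y) \<le> L * norm (z - y)"
        by (simp add: power2_eq_square mult.assoc)
      moreover have "L \<ge> 0" using lip by (rule lipschitz_on_nonneg)
      ultimately have "k * norm (z - y) \<le> L"
        by (cases "norm (z - y) = 0") (auto simp: mult_le_cancel_right)
      then show ?thesis using \<open>k > 0\<close> by (simp add: u_def norm_minus_commute)
    qed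
    moreover
    define m where "m i = max 0 (g z $ i)" for i
    define gr where "gr = (z - xs) + k *\<^sub>R (2 *\<^sub>R (z - y) + (\<Sum>i\<in>UNIV. (2 * m i) *\<^sub>R comp_gradient g i z)
        + (\<Sum>j\<in>UNIV. (2 * h z $ j) *\<^sub>R comp_gradient h j z))"
    have "- gr \<in> regular_subdifferential (indicator_fun \<Omega>) z"
    proof (rule regular_subdifferential_local_min)
      \<comment> \<open>Now \<open>y\<close> is held fixed. The squared positive parts are replaced
        by the majorants of \<open>max_0_square_le\<close> at \<open>t = g z $ i\<close>, so that
        \<open>?Q\<close> has gradient \<open>gr\<close> at \<open>z\<close>.\<close>
      let ?Q = "\<lambda>x. 1/2 * (norm (x - xs))\<^sup>2 + k * ((norm (x - y))\<^sup>2
        + (\<Sum>i\<in>UNIV. (m i + g x $ i - g z $ i)\<^sup>2) + (\<Sum>j\<in>UNIV. (h x $ j)\<^sup>2))"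
      have "GDERIV (\<lambda>x. 1/2 * (norm (x - xs))\<^sup>2) z :> (1/2) *\<^sub>R (2 *\<^sub>R (z - xs))"
        by (rule GDERIV_DERIV_compose[OF gderiv_norm_diff_square]) (auto intro!: derivative_eq_intros)
      moreover have "GDERIV (\<lambda>x. (m i + g x $ i - g z $ i)\<^sup>2) z :> (2 * m i) *\<^sub>R comp_gradient g i z" for i
        by (rule GDERIV_DERIV_compose[OF dg[OF B(1)[OF zB(1)]], of "\<lambda>s. (m i + s - g z $ i)\<^sup>2"])
          (auto intro!: derivative_eq_intros)
      moreover have "GDERIV (\<lambda>x. (h x $ j)\<^sup>2) z :> (2 * h z $ j) *\<^sub>R comp_gradient h j z" for j
        by (rule GDERIV_DERIV_compose[OF dh[OF B(2)[OF zB(1)]], of "\<lambda>s. s\<^sup>2"])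
          (auto intro!: derivative_eq_intros)
      ultimately have "GDERIV ?Q z :> (1/2) *\<^sub>R (2 *\<^sub>R (z - xs)) + k *\<^sub>R (2 *\<^sub>R (z - y)
          + (\<Sum>i\<in>UNIV. (2 * m i) *\<^sub>R comp_gradient g i z) + (\<Sum>j\<in>UNIV. (2 * h z $ j) *\<^sub>R comp_gradient h j z))"
        by (intro GDERIV_add GDERIV_DERIV_compose[where g = "\<lambda>s. k * s"] gderiv_sum gderiv_norm_diff_square)
          (auto intro!: derivative_eq_intros)
      then show "GDERIV ?Q z :> gr" by (simp add: gr_def)
      show "\<rho> - dist xs z > 0" using yz by simp
      show "\<bar>indicator_fun \<Omega> z\<bar> \<noteq> \<infinity>" using zB by (simp add: indicator_fun_def)
      fix x assume "x \<in> ball z (\<rho> - dist xs z)"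
      then have xB: "x \<in> B" by (rule inB)
      show "indicator_fun \<Omega> z + ereal (?Q z) \<le> indicator_fun \<Omega> x + ereal (?Q x)"
      proof (cases "x \<in> \<Omega>")
        case True
        then have "(y, x) \<in> K" using xB yB by (simp add: K_def)
        have "f y + ?Q z = F p + k * P p" by (simp add: F_def P_def p m_def)
        also have "\<dots> \<le> F (y, x) + k * P (y, x)" using min \<open>(y, x) \<in> K\<close> .
        also have "\<dots> \<le> f y + ?Q x"
        proof -
          have "P (y, x) \<le> (norm (x - y))\<^sup>2 + (\<Sum>i\<in>UNIV. (m i + g x $ i - g z $ i)\<^sup>2) + (\<Sum>j\<in>UNIV. (h x $ j)\<^sup>2)"
            unfolding P_def m_def fst_conv snd_conv
            by (intro add_mono sum_mono max_0_square_le order_refl)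
          then show ?thesis using \<open>k > 0\<close> by (simp add: F_def)
        qed
        finally show ?thesis using True zB by (simp add: indicator_fun_def)
      qed (simp add: indicator_fun_def)
    qed (simp add: indicator_fun_def)
    \<comment> \<open>The coupling contributes \<open>(2 * k) *\<^sub>R (z - y)\<close> to both
      \<open>u\<close> and \<open>gr\<close>, so it cancels. The multipliers are the derivatives of
      the penalty terms.\<close>
    moreover have "u + (\<Sum>i\<in>UNIV. (2 * k * m i) *\<^sub>R comp_gradient g i z)
        + (\<Sum>j\<in>UNIV. (2 * k * h z $ j) *\<^sub>R comp_gradient h j z) + - gr = xs - z"
      by (simp add: u_def gr_def scaleR_add_right scaleR_diff_right scaleR_sum_right mult_ac)
    moreover have "0 \<le> 2 * k * m i" for i using \<open>k > 0\<close> by (simp add: m_def)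
    moreover have "2 * k * m i = 0" if "g xs $ i \<noteq> 0" for i
    proof -
      have "g xs $ i < 0" using that xsf(2)[of i] by simp
      then have "g z $ i < 0" using B(5)[OF zB(1)] by blast
      then show ?thesis by (simp add: m_def)
    qed
    ultimately show "\<exists>y z u w lam mu. y \<in> ball xs \<epsilon> \<and> z \<in> ball xs \<epsilon> \<and> norm u \<le> 2 * L
      \<and> u \<in> regular_subdifferential (\<lambda>x. ereal (f x)) y
      \<and> w \<in> regular_subdifferential (indicator_fun \<Omega>) z
      \<and> (\<forall>i. 0 \<le> lam i) \<and> (\<forall>i. g xs $ i \<noteq> 0 \<longrightarrow> lam i = 0)
      \<and> u + (\<Sum>i\<in>UNIV. lam i *\<^sub>R comp_gradient g i z) + (\<Sum>j\<in>UNIV. mu j *\<^sub>R comp_gradient h j z) + w = xs - z"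
      using yz by (intro exI[of _ y] exI[of _ z] exI[of _ u] exI[of _ "- gr"] exI[of _ "\<lambda>i. 2 * k * m i"]
        exI[of _ "\<lambda>j. 2 * k * h z $ j"]) auto
  qed
qed

section \<open>Constant rank and the gradients indexed by \<open>J\<close>\<close>

lemma span_image_family:
  assumes "finite J" "\<not> dependent_family v J" "x \<in> span (v ` J)"
  shows "\<exists>c. x = (\<Sum>j\<in>J. c j *\<^sub>R v j)"
proof -
  have inj: "inj_on v J" using assms dependent_family_iff by blast
  obtain c where "x = (\<Sum>y\<in>v ` J. c y *\<^sub>R y)"
    using assms(1,3) span_finite[of "v ` J"] by auto
  then show ?thesis using inj by (auto simp: sum.reindex)
qed

text \<open>At \<open>x0\<close> the constant rank equals \<open>card J\<close>. Nearby, the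
  \<open>J\<close>-gradients stay independent by continuity, so they already span a subspace of full
  rank inside the span of all gradients.\<close>

lemma eventually_gradient_span:
  fixes v :: "'i::finite \<Rightarrow> 'a::euclidean_space \<Rightarrow> 'a"
  assumes cont: "\<And>i. isCont (v i) x0" and indep: "\<not> dependent_family (\<lambda>i. v i x0) J"
    and span: "span ((\<lambda>i. v i x0) ` J) = span (range (\<lambda>i. v i x0))"
    and rank: "\<And>x. x \<in> cball x0 \<delta> \<Longrightarrow> dim (range (\<lambda>i. v i x)) = r" and "\<delta> > 0"
  obtains e where "e > 0" "\<And>x. x \<in> ball x0 e \<Longrightarrow> \<not> dependent_family (\<lambda>i. v i x) J"
    "\<And>x. x \<in> ball x0 e \<Longrightarrow> span ((\<lambda>i. v i x) ` J) = span (range (\<lambda>i. v i x))"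
proof -
  have dimJ: "dim ((\<lambda>i. v i x) ` J) = card J" if "\<not> dependent_family (\<lambda>i. v i x) J" for x
    using that by (simp add: dependent_family_iff dim_eq_card_independent card_image)
  have r: "r = card J"
    using rank[of x0] \<open>\<delta> > 0\<close> dimJ[OF indep] span by (metis centre_in_cball dim_span less_imp_le)
  obtain e where e: "e > 0" "\<forall>x\<in>ball x0 e. \<not> dependent_family (\<lambda>i. v i x) J"
    using eventually_independent_family[OF cont indep] by blast
  show thesis
  proof (rule that[of "min e \<delta>"])
    fix x assume x: "x \<in> ball x0 (min e \<delta>)"
    then show nd: "\<not> dependent_family (\<lambda>i. v i x) J" using e by auto
    have "dim (range (\<lambda>i. v i x)) \<le> dim ((\<lambda>i. v i x) ` J)"
      using rank[of x] x r dimJ[OF nd] by simp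
    then show "span ((\<lambda>i. v i x) ` J) = span (range (\<lambda>i. v i x))"
      by (intro dim_eq_span) auto
  qed (use e \<open>\<delta> > 0\<close> in auto)
qed

section \<open>Passage to the limit under RCPLD\<close>

theorem corollary3:
  fixes f :: "real ^ 'd \<Rightarrow> real"
    and g :: "real ^ 'd \<Rightarrow> real ^ 'n"
    and h :: "real ^ 'd \<Rightarrow> real ^ 'm"
    and \<Omega> :: "(real ^ 'd) set"
    and xs :: "real ^ 'd"
    and J :: "'m set"
  assumes "closed \<Omega>"
    and "local_minimizer_on f (feasible_set \<Omega> g h) xs"
    and "lipschitz_around f xs"
    and "smooth_around g xs"
    and "smooth_around h xs"
    and "gradient_basis h J xs"
    and "RCPLD \<Omega> g h J xs"
  shows "\<exists>(lam :: real ^ 'n) (mu :: real ^ 'm).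
     0 \<in> limiting_subdifferential (\<lambda>x. ereal (f x)) xs
         + {\<Sum>i\<in>UNIV. (lam $ i) *\<^sub>R comp_gradient g i xs}
         + {\<Sum>j\<in>UNIV. (mu $ j) *\<^sub>R comp_gradient h j xs}
         + limiting_normal_cone \<Omega> xs \<and>
     (\<forall>i. lam $ i \<ge> 0 \<and> lam $ i * g xs $ i = 0)"
proof -
  have xs\<Omega>: "xs \<in> \<Omega>" using assms(2) by (auto simp: local_minimizer_on_def feasible_set_def)
  have cg: "isCont (comp_gradient g i) xs" for i
    using smooth_around_comp_gradient[OF assms(4)] by (metis continuous_on_eq_continuous_at)
  have ch: "isCont (comp_gradient h j) xs" for j
    using smooth_around_comp_gradient[OF assms(5)] by (metis continuous_on_eq_continuous_at)
  have fcont: "isCont f xs"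
    using assms(3) lipschitz_on_continuous_on unfolding lipschitz_around_def
    by (metis continuous_on_eq_continuous_at)
  obtain \<delta> r where "\<delta> > 0"
    and rank: "\<And>x. x \<in> cball xs \<delta> \<Longrightarrow> dim (range (\<lambda>j. comp_gradient h j x)) = r"
    and pld: "\<forall>I \<subseteq> active_indices g xs.
        (\<exists>lam mu. (\<forall>i\<in>I. lam i \<ge> (0::real)) \<and>
           ((\<exists>i\<in>I. lam i \<noteq> 0) \<or> (\<exists>j\<in>J. mu j \<noteq> 0)) \<and>
           0 \<in> {\<Sum>i\<in>I. lam i *\<^sub>R comp_gradient g i xs} + {\<Sum>j\<in>J. mu j *\<^sub>R comp_gradient h j xs}
                 + limiting_normal_cone \<Omega> xs) \<longrightarrow>
        (\<forall>x\<in>cball xs \<delta>. dependent_family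
           (case_sum (\<lambda>i. comp_gradient g i x) (\<lambda>j. comp_gradient h j x)) (I <+> J))"
    using assms(7) unfolding RCPLD_def by (elim exE conjE) (rule that, assumption, erule bspec, assumption+)
  have basis: "\<not> dependent_family (\<lambda>j. comp_gradient h j xs) J"
    "span ((\<lambda>j. comp_gradient h j xs) ` J) = span (range (\<lambda>j. comp_gradient h j xs))"
    using assms(6) unfolding gradient_basis_def by blast+
  obtain e where "e > 0"
    and indep: "\<And>x. x \<in> ball xs e \<Longrightarrow> \<not> dependent_family (\<lambda>j. comp_gradient h j x) J"
    and span: "\<And>x. x \<in> ball xs e \<Longrightarrow>
      span ((\<lambda>j. comp_gradient h j x) ` J) = span (range (\<lambda>j. comp_gradient h j x))"
    using eventually_gradient_span[OF ch basis rank \<open>\<delta> > 0\<close>] by blast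
  obtain L where kkt: "\<And>\<epsilon>. \<epsilon> > 0 \<Longrightarrow> \<exists>y z u w lam mu. y \<in> ball xs \<epsilon> \<and> z \<in> ball xs \<epsilon> \<and> norm u \<le> L
    \<and> u \<in> regular_subdifferential (\<lambda>x. ereal (f x)) y
    \<and> w \<in> regular_subdifferential (indicator_fun \<Omega>) z
    \<and> (\<forall>i. 0 \<le> lam i) \<and> (\<forall>i. g xs $ i \<noteq> 0 \<longrightarrow> lam i = 0)
    \<and> u + (\<Sum>i\<in>UNIV. lam i *\<^sub>R comp_gradient g i z) + (\<Sum>j\<in>UNIV. mu j *\<^sub>R comp_gradient h j z) + w = xs - z"
    using approximate_KKT[OF assms(1-5)] by blast
  let ?indep = "\<lambda>I z. \<not> dependent_family (case_sum (\<lambda>i. comp_gradient g i z) (\<lambda>j. comp_gradient h j z)) (I <+> J)"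
  have exists_data: "\<forall>k. \<exists>y z u w (lam :: real ^ 'n) (mu :: real ^ 'm) I.
      dist xs y < inverse (real (Suc k)) \<and> dist xs z < inverse (real (Suc k)) \<and> norm u \<le> L
    \<and> u \<in> regular_subdifferential (\<lambda>x. ereal (f x)) y
    \<and> w \<in> regular_subdifferential (indicator_fun \<Omega>) z
    \<and> (\<forall>i. 0 \<le> lam $ i) \<and> (\<forall>i. i \<notin> I \<longrightarrow> lam $ i = 0) \<and> (\<forall>j. j \<notin> J \<longrightarrow> mu $ j = 0)
    \<and> I \<subseteq> active_indices g xs \<and> ?indep I z
    \<and> u + (\<Sum>i\<in>UNIV. lam $ i *\<^sub>R comp_gradient g i z) + (\<Sum>j\<in>UNIV. mu $ j *\<^sub>R comp_gradient h j z) + w = xs - z"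
    (is "\<forall>k. \<exists>y z u w lam mu I. ?R k y z u w lam mu I")
  proof
    fix k
    \<comment> \<open>The bound \<open>e\<close> keeps \<open>z\<close> where the
      \<open>J\<close>-gradients form a basis of the span; the other bound drives \<open>y\<close>
      and \<open>z\<close> to \<open>xs\<close>.\<close>
    have "min e (inverse (real (Suc k))) > 0" using \<open>e > 0\<close> by simp
    from kkt[OF this] obtain y z u w lam mu
      where yz: "dist xs y < inverse (real (Suc k))" "dist xs z < inverse (real (Suc k))" "z \<in> ball xs e"
      and uw: "norm u \<le> L" "u \<in> regular_subdifferential (\<lambda>x. ereal (f x)) y"
        "w \<in> regular_subdifferential (indicator_fun \<Omega>) z"
      and lam: "\<forall>i. 0 \<le> lam i" "\<forall>i. g xs $ i \<noteq> 0 \<longrightarrow> lam i = 0"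
      and eq: "u + (\<Sum>i\<in>UNIV. lam i *\<^sub>R comp_gradient g i z) + (\<Sum>j\<in>UNIV. mu j *\<^sub>R comp_gradient h j z) + w = xs - z"
      unfolding mem_ball min_less_iff_conj by blast
    let ?A = "active_indices g xs"
    have "(\<Sum>j\<in>UNIV. mu j *\<^sub>R comp_gradient h j z) \<in> span ((\<lambda>j. comp_gradient h j z) ` J)"
      unfolding span[OF yz(3)] by (intro span_sum span_scale span_base) auto
    then obtain mu1 where mu1: "(\<Sum>j\<in>UNIV. mu j *\<^sub>R comp_gradient h j z) = (\<Sum>j\<in>J. mu1 j *\<^sub>R comp_gradient h j z)"
      using span_image_family[OF _ indep[OF yz(3)]] by auto
    have lamA: "(\<Sum>i\<in>UNIV. lam i *\<^sub>R comp_gradient g i z) = (\<Sum>i\<in>?A. lam i *\<^sub>R comp_gradient g i z)"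
      by (rule sum.mono_neutral_right) (auto simp: lam active_indices_def)
    obtain I lam' mu' where I: "I \<subseteq> ?A" "\<forall>i\<in>I. 0 \<le> lam' i" "?indep I z"
      and eq': "(\<Sum>i\<in>I. lam' i *\<^sub>R comp_gradient g i z) + (\<Sum>j\<in>J. mu' j *\<^sub>R comp_gradient h j z)
        = (\<Sum>i\<in>?A. lam i *\<^sub>R comp_gradient g i z) + (\<Sum>j\<in>J. mu1 j *\<^sub>R comp_gradient h j z)"
      using conic_reduction[where ?I0.0 = ?A and a = "\<lambda>i. comp_gradient g i z" and lam = lam and mu = mu1,
          OF finite finite lam(1)[rule_format] indep[OF yz(3)]]
      by blast
    \<comment> \<open>Padding with zeros puts the multipliers for all index sets into one fixed
      space, where limits can be taken.\<close>
    define l :: "real ^ 'n" where "l = (\<chi> i. if i \<in> I then lam' i else 0)"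
    define m :: "real ^ 'm" where "m = (\<chi> j. if j \<in> J then mu' j else 0)"
    have "(\<Sum>i\<in>UNIV. l $ i *\<^sub>R comp_gradient g i z) = (\<Sum>i\<in>I. lam' i *\<^sub>R comp_gradient g i z)"
      by (rule sum.mono_neutral_cong_right) (auto simp: l_def)
    moreover have "(\<Sum>j\<in>UNIV. m $ j *\<^sub>R comp_gradient h j z) = (\<Sum>j\<in>J. mu' j *\<^sub>R comp_gradient h j z)"
      by (rule sum.mono_neutral_cong_right) (auto simp: m_def)
    ultimately have "u + (\<Sum>i\<in>UNIV. l $ i *\<^sub>R comp_gradient g i z)
        + (\<Sum>j\<in>UNIV. m $ j *\<^sub>R comp_gradient h j z) + w = xs - z"
      using eq eq' mu1 lamA by (simp add: add.assoc)
    then show "\<exists>y z u w lam mu I. ?R k y z u w lam mu I" using yz uw I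
      by (intro exI[of _ y] exI[of _ z] exI[of _ u] exI[of _ w] exI[of _ l] exI[of _ m] exI[of _ I])
        (auto simp: l_def m_def)
  qed
  obtain Y Z U W and lam :: "nat \<Rightarrow> real ^ 'n" and mu :: "nat \<Rightarrow> real ^ 'm" and I
    where data: "\<forall>k. ?R k (Y k) (Z k) (U k) (W k) (lam k) (mu k) (I k)"
    using exists_data unfolding choice_iff by (elim exE) (rule that)
  have Y: "dist xs (Y k) < inverse (real (Suc k))" and Z: "dist xs (Z k) < inverse (real (Suc k))"
    and U: "norm (U k) \<le> L" "U k \<in> regular_subdifferential (\<lambda>x. ereal (f x)) (Y k)"
    and W: "W k \<in> regular_subdifferential (indicator_fun \<Omega>) (Z k)"
    and lam': "\<forall>i. 0 \<le> lam k $ i" "\<forall>i. i \<notin> I k \<longrightarrow> lam k $ i = 0"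
    and mu': "\<forall>j. j \<notin> J \<longrightarrow> mu k $ j = 0"
    and I: "I k \<subseteq> active_indices g xs" "?indep (I k) (Z k)"
    and eq: "U k + (\<Sum>i\<in>UNIV. lam k $ i *\<^sub>R comp_gradient g i (Z k))
      + (\<Sum>j\<in>UNIV. mu k $ j *\<^sub>R comp_gradient h j (Z k)) + W k = xs - Z k" for k
    using data[THEN spec, of k] by blast+
  note lam = lam'[rule_format] and mu = mu'[rule_format]
  \<comment> \<open>The index type is finite, so there are only finitely many possible sets
    \<open>I k\<close>.\<close>
  have "\<exists>k0\<in>UNIV. infinite {k\<in>UNIV. I k = I k0}"
    by (rule pigeonhole_infinite[OF infinite_UNIV_nat finite])
  then obtain k0 where const: "infinite {k. I k = I k0}" by auto
  obtain \<tau> :: "nat \<Rightarrow> nat" where \<tau>: "strict_mono \<tau>" "\<forall>k. \<tau> k \<in> {k. I k = I k0}"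
    using infinite_enumerate[OF const] by (elim exE conjE) (rule that)
  \<comment> \<open>The summand 1 keeps \<open>s k\<close> positive and at most 1, and gives the
    identity \<open>s k + norm (s k *\<^sub>R lam k, s k *\<^sub>R mu k) = 1\<close>. In the limit,
    \<open>s'\<close>, \<open>a\<close> and \<open>b\<close> thus cannot all vanish.
    \<open>U k\<close> enters \<open>T\<close> unscaled, being bounded by \<open>L\<close>
    already.\<close>
  define s where "s k = inverse (1 + norm (lam k, mu k))" for k
  define T where "T k = (s k, s k *\<^sub>R lam k, s k *\<^sub>R mu k, U k)" for k
  have s: "0 < s k" "s k \<le> 1" "s k + norm (s k *\<^sub>R lam k, s k *\<^sub>R mu k) = 1" for k
  proof -
    have pos: "1 + norm (lam k, mu k) > 0" using norm_ge_zero[of "(lam k, mu k)"] by linarith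
    then show "0 < s k" by (simp add: s_def)
    show "s k \<le> 1" unfolding s_def by (rule inverse_le_1_iff[THEN iffD2]) simp
    have "s k + norm (s k *\<^sub>R (lam k, mu k)) = s k * (1 + norm (lam k, mu k))"
      using \<open>0 < s k\<close> by (simp add: distrib_left del: norm_Pair scaleR_Pair)
    also have "\<dots> = 1" using pos by (simp add: s_def)
    finally show "s k + norm (s k *\<^sub>R lam k, s k *\<^sub>R mu k) = 1" by simp
  qed
  have "T (\<tau> k) \<in> cball 0 1 \<times> cball 0 1 \<times> cball 0 1 \<times> cball 0 L" for k
    using s[of "\<tau> k"] U(1)[of "\<tau> k"] norm_fst_le[of "s (\<tau> k) *\<^sub>R lam (\<tau> k)" "s (\<tau> k) *\<^sub>R mu (\<tau> k)"]
      norm_snd_le[of "s (\<tau> k) *\<^sub>R mu (\<tau> k)" "s (\<tau> k) *\<^sub>R lam (\<tau> k)"]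
    by (simp add: T_def del: norm_Pair norm_scaleR)
  moreover have "compact ((cball 0 1 :: real set) \<times> (cball 0 1 :: (real ^ 'n) set) \<times> (cball 0 1 :: (real ^ 'm) set) \<times> (cball 0 L :: (real ^ 'd) set))"
    by (intro compact_Times compact_cball)
  ultimately obtain t \<sigma> where "strict_mono \<sigma>" and t: "((\<lambda>k. T (\<tau> k)) \<circ> \<sigma>) \<longlonglongrightarrow> t"
    unfolding compact_def by (metis (no_types, lifting))
  obtain s' a b u where t_eq: "t = (s', a, b, u)" by (cases t) auto
  define \<phi> where "\<phi> = \<tau> \<circ> \<sigma>"
  have \<phi>: "strict_mono \<phi>" "\<And>k. I (\<phi> k) = I k0"
    using \<tau> \<open>strict_mono \<sigma>\<close> by (auto simp: \<phi>_def strict_mono_o)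
  have T: "(\<lambda>k. T (\<phi> k)) \<longlonglongrightarrow> (s', a, b, u)"
    using t by (simp add: t_eq \<phi>_def o_def)
  have lims: "(\<lambda>k. s (\<phi> k)) \<longlonglongrightarrow> s'" "(\<lambda>k. s (\<phi> k) *\<^sub>R lam (\<phi> k)) \<longlonglongrightarrow> a"
    "(\<lambda>k. s (\<phi> k) *\<^sub>R mu (\<phi> k)) \<longlonglongrightarrow> b" "(\<lambda>k. U (\<phi> k)) \<longlonglongrightarrow> u"
    using tendsto_fst[OF T] tendsto_fst[OF tendsto_snd[OF T]] tendsto_fst[OF tendsto_snd[OF tendsto_snd[OF T]]]
      tendsto_snd[OF tendsto_snd[OF tendsto_snd[OF T]]] by (simp_all add: T_def)
  have conv: "(\<lambda>k. X (\<phi> k)) \<longlonglongrightarrow> xs" if "\<And>k. dist xs (X k) < inverse (real (Suc k))" for X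
  proof -
    have "X \<longlonglongrightarrow> xs" using that by (rule tendsto_of_dist_less_inverse_Suc)
    from LIMSEQ_subseq_LIMSEQ[OF this \<phi>(1)] show ?thesis by (simp add: o_def)
  qed
  have Y': "(\<lambda>k. Y (\<phi> k)) \<longlonglongrightarrow> xs" and Z': "(\<lambda>k. Z (\<phi> k)) \<longlonglongrightarrow> xs"
    by (intro conv Y Z)+
  have ai: "(\<lambda>k. s (\<phi> k) * lam (\<phi> k) $ i) \<longlonglongrightarrow> a $ i" for i using tendsto_vec_nth[OF lims(2)] by simp
  have bj: "(\<lambda>k. s (\<phi> k) * mu (\<phi> k) $ j) \<longlonglongrightarrow> b $ j" for j using tendsto_vec_nth[OF lims(3)] by simp
  have a0: "a $ i \<ge> 0" for i
    by (rule LIMSEQ_le_const[OF ai]) (use lam(1) s(1) in \<open>simp add: less_imp_le\<close>)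
  have aI: "a $ i = 0" if "i \<notin> I k0" for i
    using ai[of i] lam(2)[of i] that \<phi>(2) by (simp add: LIMSEQ_const_iff)
  have bJ: "b $ j = 0" if "j \<notin> J" for j
    using bj[of j] mu[OF that] by (simp add: LIMSEQ_const_iff)
  define v where "v = (\<Sum>i\<in>UNIV. a $ i *\<^sub>R comp_gradient g i xs) + (\<Sum>j\<in>UNIV. b $ j *\<^sub>R comp_gradient h j xs)"
  \<comment> \<open>The value that the limiting relation dictates for the scaled normals: every
    other term of the approximate relation converges, hence so do they.\<close>
  define w where "w = - (s' *\<^sub>R u) - v"
  have sW: "s k *\<^sub>R W k = s k *\<^sub>R (xs - Z k) - s k *\<^sub>R U k
      - ((\<Sum>i\<in>UNIV. (s k * lam k $ i) *\<^sub>R comp_gradient g i (Z k))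
        + (\<Sum>j\<in>UNIV. (s k * mu k $ j) *\<^sub>R comp_gradient h j (Z k)))" for k
  proof -
    have "W k = (xs - Z k) - U k - ((\<Sum>i\<in>UNIV. lam k $ i *\<^sub>R comp_gradient g i (Z k))
        + (\<Sum>j\<in>UNIV. mu k $ j *\<^sub>R comp_gradient h j (Z k)))"
      using eq[of k] by (simp add: algebra_simps)
    then show ?thesis
      by (simp only: scaleR_diff_right scaleR_add_right scaleR_sum_right scaleR_scaleR)
  qed
  have "(\<lambda>k. s (\<phi> k) *\<^sub>R W (\<phi> k)) \<longlonglongrightarrow> s' *\<^sub>R (xs - xs) - s' *\<^sub>R u - v"
    unfolding sW v_def
    by (intro tendsto_intros lims Z' ai bj isCont_tendsto_compose[OF cg Z'] isCont_tendsto_compose[OF ch Z'])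
  then have "(\<lambda>k. s (\<phi> k) *\<^sub>R W (\<phi> k)) \<longlonglongrightarrow> w" by (simp add: w_def)
  then have cw: "(\<lambda>k. c *\<^sub>R s (\<phi> k) *\<^sub>R W (\<phi> k)) \<longlonglongrightarrow> c *\<^sub>R w" for c
    by (intro tendsto_intros)
  \<comment> \<open>The factor \<open>c\<close> serves two uses: 1 when condition (ii) is applied,
    and \<open>inverse s'\<close> in the final division.\<close>
  have w: "c *\<^sub>R w \<in> limiting_normal_cone \<Omega> xs" if "c > 0" for c
    by (rule limiting_normal_coneI[OF xs\<Omega> Z' cw]) (intro regular_normal_scaleR W s(1) that)
  have norm1: "s' + norm (a, b) = 1"
  proof (rule LIMSEQ_unique)
    show "(\<lambda>k. s (\<phi> k) + norm (s (\<phi> k) *\<^sub>R lam (\<phi> k), s (\<phi> k) *\<^sub>R mu (\<phi> k))) \<longlonglongrightarrow> s' + norm (a, b)"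
      by (intro tendsto_intros lims)
  qed (simp add: s(3) del: norm_Pair)
  have "s' \<ge> 0" by (rule LIMSEQ_le_const[OF lims(1)]) (use s(1) in \<open>simp add: less_imp_le\<close>)
  have "s' \<noteq> 0"
  proof
    assume "s' = 0"
    then have "(a, b) \<noteq> 0" using norm1 by (metis add_0 norm_zero zero_neq_one)
    then have "(\<exists>i. a $ i \<noteq> 0) \<or> (\<exists>j. b $ j \<noteq> 0)" by (auto simp: vec_eq_iff zero_prod_def)
    then have nz: "(\<exists>i\<in>I k0. a $ i \<noteq> 0) \<or> (\<exists>j\<in>J. b $ j \<noteq> 0)" using aI bJ by blast
    have v: "v = (\<Sum>i\<in>I k0. a $ i *\<^sub>R comp_gradient g i xs) + (\<Sum>j\<in>J. b $ j *\<^sub>R comp_gradient h j xs)"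
      unfolding v_def
      by (intro arg_cong2[where f = "(+)"] sum.mono_neutral_right) (auto simp: aI bJ)
    have "0 = v + w" using \<open>s' = 0\<close> by (simp add: w_def)
    also have "\<dots> \<in> {\<Sum>i\<in>I k0. a $ i *\<^sub>R comp_gradient g i xs} + {\<Sum>j\<in>J. b $ j *\<^sub>R comp_gradient h j xs}
        + limiting_normal_cone \<Omega> xs"
      unfolding v using w[of 1] by (intro set_plus_intro singletonI) simp
    finally have 0: "0 \<in> {\<Sum>i\<in>I k0. a $ i *\<^sub>R comp_gradient g i xs}
        + {\<Sum>j\<in>J. b $ j *\<^sub>R comp_gradient h j xs} + limiting_normal_cone \<Omega> xs" .
    \<comment> \<open>Condition (ii) forces dependence on the whole ball of radius \<delta>. A
      single iterate inside it refutes this, because the family for the same set \<open>I k0\<close>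
      is independent there.\<close>
    have "\<forall>\<^sub>F k in sequentially. dist (Z (\<phi> k)) xs < \<delta>" using Z' \<open>\<delta> > 0\<close> by (rule tendstoD)
    then obtain k where "dist (Z (\<phi> k)) xs < \<delta>" by (auto simp: eventually_sequentially)
    then have "Z (\<phi> k) \<in> cball xs \<delta>" by (simp add: dist_commute)
    moreover have "\<forall>x\<in>cball xs \<delta>. dependent_family
        (case_sum (\<lambda>i. comp_gradient g i x) (\<lambda>j. comp_gradient h j x)) (I k0 <+> J)"
      by (rule pld[THEN spec, THEN mp, OF I(1), THEN mp], intro exI conjI) (use a0 nz 0 in \<open>simp_all\<close>)
    ultimately show False using I(2)[of "\<phi> k"] \<phi>(2)[of k] by simp
  qed
  with \<open>s' \<ge> 0\<close> have "s' > 0" by simp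
  have fY: "(\<lambda>k. f (Y (\<phi> k))) \<longlonglongrightarrow> f xs" by (rule isCont_tendsto_compose[OF fcont Y'])
  have u: "u \<in> limiting_subdifferential (\<lambda>x. ereal (f x)) xs"
    unfolding limiting_subdifferential_def mem_Collect_eq
    by (rule conjI, simp, rule exI[of _ "\<lambda>k. Y (\<phi> k)"], rule exI[of _ "\<lambda>k. U (\<phi> k)"])
      (use fY Y' lims(4) U(2) in auto)
  have w': "inverse s' *\<^sub>R w \<in> limiting_normal_cone \<Omega> xs"
    using w \<open>s' > 0\<close> by simp
  have "0 = inverse s' *\<^sub>R (s' *\<^sub>R u + v + w)" by (simp add: w_def)
  also have "\<dots> = u + (\<Sum>i\<in>UNIV. (inverse s' *\<^sub>R a) $ i *\<^sub>R comp_gradient g i xs)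
      + (\<Sum>j\<in>UNIV. (inverse s' *\<^sub>R b) $ j *\<^sub>R comp_gradient h j xs) + inverse s' *\<^sub>R w"
    using \<open>s' \<noteq> 0\<close> by (simp add: v_def scaleR_add_right scaleR_sum_right add.assoc)
  also have "\<dots> \<in> limiting_subdifferential (\<lambda>x. ereal (f x)) xs
         + {\<Sum>i\<in>UNIV. ((inverse s' *\<^sub>R a) $ i) *\<^sub>R comp_gradient g i xs}
         + {\<Sum>j\<in>UNIV. ((inverse s' *\<^sub>R b) $ j) *\<^sub>R comp_gradient h j xs}
         + limiting_normal_cone \<Omega> xs"
    by (intro set_plus_intro u w' singletonI)
  finally have "0 \<in> limiting_subdifferential (\<lambda>x. ereal (f x)) xs
         + {\<Sum>i\<in>UNIV. ((inverse s' *\<^sub>R a) $ i) *\<^sub>R comp_gradient g i xs}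
         + {\<Sum>j\<in>UNIV. ((inverse s' *\<^sub>R b) $ j) *\<^sub>R comp_gradient h j xs}
         + limiting_normal_cone \<Omega> xs" .
  \<comment> \<open>Complementarity holds because \<open>a\<close> is supported on
    \<open>I k0\<close>, which consists of active indices.\<close>
  moreover have "(inverse s' *\<^sub>R a) $ i \<ge> 0 \<and> (inverse s' *\<^sub>R a) $ i * g xs $ i = 0" for i
    using a0[of i] \<open>s' > 0\<close> aI[of i] I(1)[of k0] by (auto simp: active_indices_def)
  ultimately show ?thesis by blast
qed

end
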